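(* The generating function $K_1(x)=\sum_{n\ge 0} k_n^{\#1}x^n$ of the sequence $\{k_n^{\#1}\}_{n\geq0}$ is $$K_1(x)= \frac{1-6x-\sqrt{1-4x}\,\sqrt{1-8x}}{2}.$$
   Context: The m-implication of type 2 is the connective $\psi\leftharpoonup\phi\equiv\neg\psi\to\phi$, which has value 0 (false) exactly when $\psi$ and $\phi$ both have value 0, and value 1 (true) otherwise. A bracketed formula with $n$ distinct variables is obtained from $p_1\leftharpoonup p_2\leftharpoonup\cdots\leftharpoonup p_n$ (variables in this fixed order) by fully inserting brackets; for $n\ge2$ it has the form $\psi\leftharpoonup\phi$ with $\psi$ a bracketing of $p_1\leftharpoonup\cdots\leftharpoonup p_i$ and $\phi$ a bracketing of $p_{i+1}\leftharpoonup\cdots\leftharpoonup p_n$ for some $1\le i\le n-1$. A row is a pair consisting of a bracketed formula and a valuation of $p_1,\dots,p_n$ in $\{0,1\}$. For $n\ge 2$, $k_n^{\#1}$ is the number of rows (over all bracketed formulae in $n$ variables) for which $\psi$ and $\phi$ both have value 1 (so that $\psi\leftharpoonup\phi$ is true); $k_0^{\#1}=k_1^{\#1}=0$. Square roots denote formal power series with positive constant term. *)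

theory Defs
  imports Complex_Main "HOL-Library.FuncSet" "HOL-Computational_Algebra.Formal_Power_Series"
begin

datatype form =
    Var nat
  | MImp form form  (infixr "\<leftharpoonup>" 65)

text \<open>
  \<open>\<psi> \<leftharpoonup> \<phi>\<close> stands for \<open>\<not> \<psi> \<rightarrow> \<phi>\<close>; the truth values 0 and 1 are
  \<^term>\<open>False\<close> and \<^term>\<open>True\<close>.
\<close>

primrec eval :: "(nat \<Rightarrow> bool) \<Rightarrow> form \<Rightarrow> bool" where
  "eval v (Var i) = v i"
| "eval v (\<psi> \<leftharpoonup> \<phi>) = (\<not> eval v \<psi> \<longrightarrow> eval v \<phi>)"

text \<open>
  \<open>bracketing i j \<chi>\<close>: the formula \<open>\<chi>\<close> arises by fully bracketing
  \<open>p\<^sub>i \<leftharpoonup> \<dots> \<leftharpoonup> p\<^sub>j\<close>. It implies \<open>i \<le> j\<close>, so there is no bracketed formula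
  in 0 variables.
\<close>

inductive bracketing :: "nat \<Rightarrow> nat \<Rightarrow> form \<Rightarrow> bool" where
  var: "bracketing i i (Var i)"
| mimp: "bracketing i j \<psi> \<Longrightarrow> bracketing (Suc j) k \<phi> \<Longrightarrow> bracketing i k (\<psi> \<leftharpoonup> \<phi>)"

definition bracketed_formulae :: "nat \<Rightarrow> form set" where
  "bracketed_formulae n = {\<chi>. bracketing 1 n \<chi>}"

text \<open>
  Valuations are extensional, i.e. they take a fixed dummy value outside \<open>{1..n}\<close>,
  so that each assignment of truth values to \<open>p\<^sub>1, \<dots>, p\<^sub>n\<close> is counted once.
\<close>

definition valuations :: "nat \<Rightarrow> (nat \<Rightarrow> bool) set" where
  "valuations n = {1..n} \<rightarrow>\<^sub>E UNIV"

definition rows :: "nat \<Rightarrow> (form \<times> (nat \<Rightarrow> bool)) set" where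
  "rows n = bracketed_formulae n \<times> valuations n"

definition k1 :: "nat \<Rightarrow> nat" where
  "k1 n = (if n < 2 then 0
     else card {(\<chi>, v) \<in> rows n. \<exists>\<psi> \<phi>. \<chi> = \<psi> \<leftharpoonup> \<phi> \<and> eval v \<psi> \<and> eval v \<phi>})"

definition K1 :: "real fps" where
  "K1 = Abs_fps (\<lambda>n. real (k1 n))"

definition fps_sqrt :: "real fps \<Rightarrow> real fps" where
  "fps_sqrt f = fps_radical root 2 f"

text \<open>On series with positive constant term, this is the square root with positive constant term.\<close>

lemma fps_sqrt_unique:
  assumes "fps_nth f 0 > 0"
  shows "s = fps_sqrt f \<longleftrightarrow> s ^ 2 = f \<and> fps_nth s 0 > 0"
proof -
  have r0: "root (Suc 1) (fps_nth f 0) ^ Suc 1 = fps_nth f 0"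
    using assms by (intro real_root_pow_pos2) auto
  have f0: "fps_nth f 0 \<noteq> 0" using assms by simp
  have sq: "fps_sqrt f ^ 2 = f"
    using power_radical[OF f0, of root 1] r0 unfolding fps_sqrt_def
    by (simp add: numeral_2_eq_2)
  have pos: "fps_nth (fps_sqrt f) 0 > 0"
    using assms unfolding fps_sqrt_def by (simp add: numeral_2_eq_2)
  show ?thesis
  proof
    assume s: "s ^ 2 = f \<and> fps_nth s 0 > 0"
    then have "s = fps_sqrt f \<or> s = - fps_sqrt f"
      using sq power2_eq_iff by metis
    then show "s = fps_sqrt f"
    proof
      assume "s = - fps_sqrt f"
      then have "fps_nth s 0 = - fps_nth (fps_sqrt f) 0" by simp
      then show ?thesis using s pos by linarith
    qed
  qed (use sq pos in simp)
qed

lemma bracketing_le: "bracketing i j \<chi> \<Longrightarrow> i \<le> j"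
  by (induction rule: bracketing.induct) auto

text \<open>The set counted by \<^const>\<open>k1\<close> is finite, so \<^const>\<open>card\<close> is a genuine count.\<close>

lemma finite_bracketing: "finite {\<chi>. bracketing i j \<chi>}"
proof (induction "Suc j - i" arbitrary: i j rule: less_induct)
  case less
  let ?B = "\<lambda>i j. {\<chi>. bracketing i j \<chi>}"
  have "?B i j \<subseteq> insert (Var i) (\<Union>m\<in>{i..<j}. (\<lambda>(\<psi>, \<phi>). \<psi> \<leftharpoonup> \<phi>) ` (?B i m \<times> ?B (Suc m) j))"
  proof
    fix \<chi> assume "\<chi> \<in> ?B i j"
    then have "bracketing i j \<chi>" by simp
    then show "\<chi> \<in> insert (Var i) (\<Union>m\<in>{i..<j}. (\<lambda>(\<psi>, \<phi>). \<psi> \<leftharpoonup> \<phi>) ` (?B i m \<times> ?B (Suc m) j))"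
    proof cases
      case (mimp m \<psi> \<phi>)
      then have "m \<in> {i..<j}" using bracketing_le by fastforce
      then show ?thesis using mimp by auto
    qed simp
  qed
  moreover have "finite (?B i m)" "finite (?B (Suc m) j)" if "m \<in> {i..<j}" for m
    using that by (auto intro!: less)
  ultimately show ?case
    by (elim finite_subset) auto
qed

lemma finite_rows: "finite (rows n)"
  unfolding rows_def bracketed_formulae_def valuations_def
  by (intro finite_cartesian_product finite_bracketing finite_PiE) auto

end

(*
  Let F and T be the generating functions of the false and the true rows. A formula
  psi <- phi is false exactly when both parts are false, so F = X + F^2 and
  T + F = 2 X + (T + F)^2, whence 1 - 2 F and 1 - 2 (T + F) are the square roots of
  1 - 4 X and 1 - 8 X. The rows in question are pairs of true rows, so K1 = T^2.
*)
theory Submission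
  imports Defs
begin

section \<open>Locality and unique reading of bracketings\<close>

text \<open>The last variable of a compound formula is that of its right part, so induction reads it
  off. Applied to the left part of a formula, this says that the top split point is determined,
  which makes the counts over split points add up.\<close>

lemma bracketing_end_unique: "bracketing i j \<chi> \<Longrightarrow> bracketing i' j' \<chi> \<Longrightarrow> j = j'"
proof (induction arbitrary: i' j' rule: bracketing.induct)
  case (var i)
  then show ?case by (auto elim: bracketing.cases)
next
  case (mimp i j \<psi> k \<phi>)
  from mimp.prems show ?case by cases (use mimp.IH in blast)
qed

text \<open>Only variables from the range occur in the formula. This licenses restricting valuations
  to a subformula and gluing them back.\<close>

lemma eval_cong:
  "bracketing i j \<chi> \<Longrightarrow> (\<And>x. i \<le> x \<Longrightarrow> x \<le> j \<Longrightarrow> v x = w x) \<Longrightarrow> eval v \<chi> = eval w \<chi>"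
proof (induction rule: bracketing.induct)
  case (mimp i j \<psi> k \<phi>)
  have "i \<le> j" "Suc j \<le> k" using mimp.hyps bracketing_le by blast+
  then have "eval v \<psi> = eval w \<psi>" "eval v \<phi> = eval w \<phi>"
    using mimp.IH mimp.prems by simp_all
  then show ?case by simp
qed simp

section \<open>Rows over an interval of variables, split at the top connective\<close>

text \<open>The variables are \<open>p\<^sub>i, \<dots>, p\<^bsub>k-1\<^esub>\<close>: half-open ranges make the splitting symmetric.\<close>

definition rows_val :: "bool \<Rightarrow> nat \<Rightarrow> nat \<Rightarrow> (form \<times> (nat \<Rightarrow> bool)) set" where
  "rows_val b i k = {(\<chi>, v). i < k \<and> bracketing i (k - 1) \<chi> \<and>
     v \<in> {i..<k} \<rightarrow>\<^sub>E UNIV \<and> eval v \<chi> = b}"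

text \<open>One line of the truth table of the top connective; the values \<open>True\<close>,
  \<open>True\<close> give the rows that \<open>k1\<close> counts.\<close>

definition rows_val2 :: "bool \<Rightarrow> bool \<Rightarrow> nat \<Rightarrow> nat \<Rightarrow> (form \<times> (nat \<Rightarrow> bool)) set" where
  "rows_val2 b c i k = {(\<chi>, v). i < k \<and> bracketing i (k - 1) \<chi> \<and> v \<in> {i..<k} \<rightarrow>\<^sub>E UNIV \<and>
     (\<exists>\<psi> \<phi>. \<chi> = \<psi> \<leftharpoonup> \<phi> \<and> eval v \<psi> = b \<and> eval v \<phi> = c)}"

definition rows_split :: "bool \<Rightarrow> bool \<Rightarrow> nat \<Rightarrow> nat \<Rightarrow> nat \<Rightarrow> (form \<times> (nat \<Rightarrow> bool)) set" where
  "rows_split b c i m k = {(\<chi>, v). v \<in> {i..<k} \<rightarrow>\<^sub>E UNIV \<and>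
     (\<exists>\<psi> \<phi>. \<chi> = \<psi> \<leftharpoonup> \<phi> \<and> bracketing i (m - 1) \<psi> \<and> bracketing m (k - 1) \<phi> \<and>
        eval v \<psi> = b \<and> eval v \<phi> = c)}"

lemma finite_rows_val: "finite (rows_val b i k)"
proof (rule finite_subset)
  show "rows_val b i k \<subseteq> {\<chi>. bracketing i (k - 1) \<chi>} \<times> ({i..<k} \<rightarrow>\<^sub>E UNIV)"
    by (auto simp: rows_val_def)
qed (intro finite_cartesian_product finite_bracketing finite_PiE, auto)

lemma finite_rows_val2: "finite (rows_val2 b c i k)"
proof (rule finite_subset)
  show "rows_val2 b c i k \<subseteq> {\<chi>. bracketing i (k - 1) \<chi>} \<times> ({i..<k} \<rightarrow>\<^sub>E UNIV)"
    by (auto simp: rows_val2_def)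
qed (intro finite_cartesian_product finite_bracketing finite_PiE, auto)

text \<open>The two parts have disjoint variables, so a row of the compound formula is the same as
  an independent pair of rows, one for each part.\<close>

lemma card_rows_split:
  assumes "i < m" "m < k"
  shows "card (rows_split b c i m k) = card (rows_val b i m) * card (rows_val c m k)"
proof -
  define f :: "(form \<times> (nat \<Rightarrow> bool)) \<times> (form \<times> (nat \<Rightarrow> bool)) \<Rightarrow> form \<times> (nat \<Rightarrow> bool)"
    where "f = (\<lambda>((\<psi>, v), (\<phi>, w)). (\<psi> \<leftharpoonup> \<phi>, \<lambda>x. if x < m then v x else w x))"
  define g :: "form \<times> (nat \<Rightarrow> bool) \<Rightarrow> (form \<times> (nat \<Rightarrow> bool)) \<times> (form \<times> (nat \<Rightarrow> bool))"
    where "g = (\<lambda>(\<chi>, u). case \<chi> of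
       \<psi> \<leftharpoonup> \<phi> \<Rightarrow> ((\<psi>, restrict u {i..<m}), (\<phi>, restrict u {m..<k})))"
  have "bij_betw f (rows_val b i m \<times> rows_val c m k) (rows_split b c i m k)"
  proof (rule bij_betw_byWitness[where f' = g])
    show "\<forall>a\<in>rows_val b i m \<times> rows_val c m k. g (f a) = a"
      \<comment> \<open>Extensionality matters here: both valuations are \<open>undefined\<close>
        outside their ranges, so restricting the glued one recovers them exactly.\<close>
      by (auto simp: f_def g_def rows_val_def restrict_def PiE_def extensional_def fun_eq_iff)
    show "\<forall>a\<in>rows_split b c i m k. f (g a) = a"
      using assms
      by (auto simp: f_def g_def rows_split_def restrict_def PiE_def extensional_def fun_eq_iff)
    show "f ` (rows_val b i m \<times> rows_val c m k) \<subseteq> rows_split b c i m k"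
    proof clarify
      fix \<psi> v \<phi> w \<chi> u
      assume l: "(\<psi>, v) \<in> rows_val b i m" and r: "(\<phi>, w) \<in> rows_val c m k"
        and fu: "(\<chi>, u) = f ((\<psi>, v), (\<phi>, w))"
      then have \<chi>: "\<chi> = \<psi> \<leftharpoonup> \<phi>" and u: "u = (\<lambda>x. if x < m then v x else w x)"
        by (auto simp: f_def)
      have "eval u \<psi> = eval v \<psi>"
        using l assms u by (intro eval_cong[of i "m - 1"]) (auto simp: rows_val_def)
      moreover have "eval u \<phi> = eval w \<phi>"
        using r assms u by (intro eval_cong[of m "k - 1"]) (auto simp: rows_val_def)
      moreover have "u \<in> {i..<k} \<rightarrow>\<^sub>E UNIV"
        using l r assms by (auto simp: u rows_val_def PiE_def extensional_def)
      ultimately show "(\<chi>, u) \<in> rows_split b c i m k"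
        using l r \<chi> by (auto simp: rows_split_def rows_val_def)
    qed
    show "g ` rows_split b c i m k \<subseteq> rows_val b i m \<times> rows_val c m k"
    proof
      fix y assume "y \<in> g ` rows_split b c i m k"
      then obtain \<psi> \<phi> u where br: "bracketing i (m - 1) \<psi>" "bracketing m (k - 1) \<phi>"
        and ev: "eval u \<psi> = b" "eval u \<phi> = c"
        and y: "y = ((\<psi>, restrict u {i..<m}), (\<phi>, restrict u {m..<k}))"
        by (auto simp: rows_split_def g_def)
      have "eval (restrict u {i..<m}) \<psi> = eval u \<psi>"
        using br(1) assms by (intro eval_cong[of i "m - 1"]) auto
      moreover have "eval (restrict u {m..<k}) \<phi> = eval u \<phi>"
        using br(2) assms by (intro eval_cong[of m "k - 1"]) auto
      ultimately show "y \<in> rows_val b i m \<times> rows_val c m k"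
        using br ev assms y by (auto simp: rows_val_def)
    qed
  qed
  then show ?thesis
    by (metis bij_betw_same_card card_cartesian_product)
qed

lemma rows_val2_UN: "rows_val2 b c i k = (\<Union>m\<in>{i<..<k}. rows_split b c i m k)"
proof (intro subset_antisym subsetI)
  fix y assume "y \<in> rows_val2 b c i k"
  then obtain \<psi> \<phi> v where y: "y = (\<psi> \<leftharpoonup> \<phi>, v)" and br: "bracketing i (k - 1) (\<psi> \<leftharpoonup> \<phi>)"
    and ik: "i < k" and rest: "v \<in> {i..<k} \<rightarrow>\<^sub>E UNIV" "eval v \<psi> = b" "eval v \<phi> = c"
    unfolding rows_val2_def by blast
  from br obtain j where j: "bracketing i j \<psi>" "bracketing (Suc j) (k - 1) \<phi>"
    by cases auto
  \<comment> \<open>The split index is the first variable of the right part.\<close>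
  then have "Suc j \<in> {i<..<k}" using bracketing_le[OF j(1)] bracketing_le[OF j(2)] ik by auto
  moreover have "y \<in> rows_split b c i (Suc j) k"
    using y j rest by (auto simp: rows_split_def)
  ultimately show "y \<in> (\<Union>m\<in>{i<..<k}. rows_split b c i m k)" by blast
next
  fix y assume "y \<in> (\<Union>m\<in>{i<..<k}. rows_split b c i m k)"
  then obtain m where m: "i < m" "m < k" and y: "y \<in> rows_split b c i m k" by auto
  \<comment> \<open>Since \<open>m\<close> is positive, the subtraction is not truncated, and the
    right part starts where the \<open>mimp\<close> rule demands.\<close>
  then have "Suc (m - 1) = m" by simp
  then show "y \<in> rows_val2 b c i k"
    using y m bracketing.mimp[of i "m - 1" _ "k - 1"]
    by (auto simp: rows_split_def rows_val2_def)
qed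

lemma card_rows_val2:
  "card (rows_val2 b c i k) = (\<Sum>m\<in>{i<..<k}. card (rows_val b i m) * card (rows_val c m k))"
proof -
  have "card (rows_val2 b c i k) = (\<Sum>m\<in>{i<..<k}. card (rows_split b c i m k))"
    unfolding rows_val2_UN
  proof (rule card_UN_disjoint)
    show "\<forall>m\<in>{i<..<k}. finite (rows_split b c i m k)"
      using finite_rows_val2[of b c i k] unfolding rows_val2_UN by (auto intro: finite_subset)
    show "\<forall>m\<in>{i<..<k}. \<forall>m'\<in>{i<..<k}. m \<noteq> m' \<longrightarrow>
        rows_split b c i m k \<inter> rows_split b c i m' k = {}"
    proof (intro ballI impI)
      fix m m' assume "m \<in> {i<..<k}" "m' \<in> {i<..<k}" "m \<noteq> m'"
      \<comment> \<open>A common row would have one left part ending both at \<open>m - 1\<close>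
        and at \<open>m' - 1\<close>.\<close>
      then have "m - 1 \<noteq> m' - 1" by auto
      then show "rows_split b c i m k \<inter> rows_split b c i m' k = {}"
        using bracketing_end_unique by (fastforce simp: rows_split_def)
    qed
  qed simp
  then show ?thesis by (simp add: card_rows_split)
qed

section \<open>Single variables and the truth table of the connective\<close>

lemma rows_val_single: "card (rows_val b i (Suc i)) = 1"
proof -
  have "\<chi> = Var i" if "bracketing i i \<chi>" for \<chi>
    using that
  proof cases
    case (mimp j \<psi> \<phi>)
    then show ?thesis using bracketing_le[of i j] bracketing_le[of "Suc j" i] by fastforce
  qed
  then have br: "bracketing i i \<chi> \<longleftrightarrow> \<chi> = Var i" for \<chi>
    using bracketing.var by blast
  \<comment> \<open>Outside \<open>i\<close> an extensional valuation is forced, so prescribing its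
    value at \<open>i\<close> leaves exactly one.\<close>
  have v: "v \<in> {i..<Suc i} \<rightarrow>\<^sub>E UNIV \<and> v i = b \<longleftrightarrow> v = (\<lambda>x. if x = i then b else undefined)"
    for v :: "nat \<Rightarrow> bool"
  proof
    assume "v \<in> {i..<Suc i} \<rightarrow>\<^sub>E UNIV \<and> v i = b"
    then show "v = (\<lambda>x. if x = i then b else undefined)"
      by (intro ext) (simp add: PiE_def extensional_def)
  qed (simp add: PiE_def extensional_def)
  have "(\<chi>, v) \<in> rows_val b i (Suc i) \<longleftrightarrow>
      \<chi> = Var i \<and> v \<in> {i..<Suc i} \<rightarrow>\<^sub>E UNIV \<and> v i = b" for \<chi> v
    unfolding rows_val_def using br by (simp cong: conj_cong)
  then have "rows_val b i (Suc i) = {(Var i, \<lambda>x. if x = i then b else undefined)}"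
    unfolding v by auto
  then show ?thesis by simp
qed

lemma bracketing_MImp:
  assumes "bracketing i j \<chi>" "i \<noteq> j"
  obtains \<psi> \<phi> where "\<chi> = \<psi> \<leftharpoonup> \<phi>"
  using assms by (auto elim: bracketing.cases)

text \<open>The connective is disjunction in disguise. With at least two variables every formula is
  compound, so its rows can be sorted by the values of the two parts.\<close>

lemma rows_val_UN:
  assumes "Suc i < k"
  shows "rows_val b i k = (\<Union>(c, d)\<in>{(c, d). (c \<or> d) = b}. rows_val2 c d i k)"
proof (intro subset_antisym subsetI)
  fix y assume "y \<in> rows_val b i k"
  then obtain \<chi> v where y: "y = (\<chi>, v)" and br: "bracketing i (k - 1) \<chi>"
    and v: "v \<in> {i..<k} \<rightarrow>\<^sub>E UNIV" and ev: "eval v \<chi> = b"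
    unfolding rows_val_def by blast
  from br obtain \<psi> \<phi> where \<chi>: "\<chi> = \<psi> \<leftharpoonup> \<phi>"
    using assms by (elim bracketing_MImp) auto
  have "y \<in> rows_val2 (eval v \<psi>) (eval v \<phi>) i k"
    using assms y br v \<chi> unfolding rows_val2_def by simp
  moreover have "(eval v \<psi> \<or> eval v \<phi>) = b"
    using ev \<chi> by auto
  ultimately show "y \<in> (\<Union>(c, d)\<in>{(c, d). (c \<or> d) = b}. rows_val2 c d i k)"
    by blast
qed (auto simp: rows_val_def rows_val2_def)

lemma rows_val_False:
  assumes "Suc i < k"
  shows "rows_val False i k = rows_val2 False False i k"
proof -
  have "{(c, d). (c \<or> d) = False} = {(False, False)}" by auto
  then show ?thesis by (simp add: rows_val_UN[OF assms])
qed

lemma card_rows_val_True: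
  assumes "Suc i < k"
  shows "card (rows_val True i k) = card (rows_val2 True True i k)
    + card (rows_val2 True False i k) + card (rows_val2 False True i k)"
proof -
  have "rows_val True i k =
      rows_val2 True True i k \<union> rows_val2 True False i k \<union> rows_val2 False True i k"
  proof -
    have "{(c, d). (c \<or> d) = True} = {(True, True), (True, False), (False, True)}" by auto
    then show ?thesis by (simp add: rows_val_UN[OF assms] Un_assoc)
  qed
  moreover have "(rows_val2 True True i k \<union> rows_val2 True False i k) \<inter> rows_val2 False True i k = {}"
    "rows_val2 True True i k \<inter> rows_val2 True False i k = {}"
    by (auto simp: rows_val2_def)
  ultimately show ?thesis
    by (simp add: card_Un_disjoint finite_rows_val2)
qed

section \<open>Counts depend only on the number of variables\<close>

definition num_val :: "bool \<Rightarrow> nat \<Rightarrow> nat" where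
  "num_val b n = card (rows_val b 0 n)"

lemma sum_shift:
  "(\<Sum>m\<in>{i<..<i + n}. f m) = (\<Sum>l\<in>{0<..<n}. f (i + l))" for f :: "nat \<Rightarrow> nat"
  by (rule sum.reindex_bij_witness[where i = "\<lambda>l. i + l" and j = "\<lambda>m. m - i"]) auto

text \<open>Instead of renaming variables by a bijection, strong induction shows that counts at
  every starting index obey the same convolution.\<close>

lemma card_rows_val: "card (rows_val b i (i + n)) = num_val b n"
proof (induction n arbitrary: b i rule: less_induct)
  case (less n)
  \<comment> \<open>The right-hand side does not mention \<open>i\<close>. As
    \<open>0 < l < n\<close>, both parts are shorter than \<open>n\<close>, and the induction
    hypothesis covers the shifted start \<open>i + l\<close> too.\<close>
  have c2: "card (rows_val2 c d i (i + n)) = (\<Sum>l\<in>{0<..<n}. num_val c l * num_val d (n - l))"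
    for c d i
    unfolding card_rows_val2 sum_shift
  proof (rule sum.cong)
    fix l assume l: "l \<in> {0<..<n}"
    then have "card (rows_val d (i + l) (i + n)) = num_val d (n - l)"
      using less[of "n - l" d "i + l"] by simp
    with l less show "card (rows_val c i (i + l)) * card (rows_val d (i + l) (i + n))
        = num_val c l * num_val d (n - l)" by simp
  qed simp
  consider "n = 0" | "n = 1" | "n > 1" by linarith
  then show ?case
  proof cases
    case 3
    \<comment> \<open>Writing \<open>0 + n\<close> lets \<open>c2\<close> rewrite both sides to the
      same sum.\<close>
    have "card (rows_val b i (i + n)) = card (rows_val b 0 (0 + n))"
    proof (cases b)
      case True
      have "card (rows_val True j (j + n)) = card (rows_val2 True True j (j + n))
        + card (rows_val2 True False j (j + n)) + card (rows_val2 False True j (j + n))" for j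
        using 3 by (intro card_rows_val_True) simp
      with True show ?thesis by (simp only: c2)
    next
      case False
      have "rows_val False j (j + n) = rows_val2 False False j (j + n)" for j
        using 3 by (intro rows_val_False) simp
      with False show ?thesis by (simp only: c2)
    qed
    then show ?thesis by (simp add: num_val_def)
  next
    case 1
    then show ?thesis by (simp add: num_val_def rows_val_def)
  next
    case 2
    then show ?thesis by (simp add: num_val_def rows_val_single)
  qed
qed

section \<open>Functional equations of the generating functions\<close>

definition gf_val :: "bool \<Rightarrow> real fps" where
  "gf_val b = Abs_fps (\<lambda>n. real (num_val b n))"

lemma num_val_0 [simp]: "num_val b 0 = 0"
  by (simp add: num_val_def rows_val_def)

lemma num_val_1 [simp]: "num_val b (Suc 0) = 1"
  by (simp add: num_val_def rows_val_single)

text \<open>The sum over split points is a Cauchy product.\<close>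

lemma real_card_rows_val2: "real (card (rows_val2 b c i (i + n))) = fps_nth (gf_val b * gf_val c) n"
proof -
  have "card (rows_val2 b c i (i + n)) = (\<Sum>l\<in>{0<..<n}. num_val b l * num_val c (n - l))"
    unfolding card_rows_val2 sum_shift
  proof (rule sum.cong)
    fix l assume "l \<in> {0<..<n}"
    then show "card (rows_val b i (i + l)) * card (rows_val c (i + l) (i + n))
        = num_val b l * num_val c (n - l)"
      using card_rows_val[of c "i + l" "n - l"] by (simp add: card_rows_val)
  qed simp
  \<comment> \<open>The added end terms vanish because \<open>num_val\<close> is 0 at 0.\<close>
  also have "\<dots> = (\<Sum>l=0..n. num_val b l * num_val c (n - l))"
  proof (rule sum.mono_neutral_left)
    show "\<forall>l\<in>{0..n} - {0<..<n}. num_val b l * num_val c (n - l) = 0"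
    proof
      fix l assume "l \<in> {0..n} - {0<..<n}"
      then have "l = 0 \<or> l = n" by auto
      then show "num_val b l * num_val c (n - l) = 0" by auto
    qed
  qed auto
  finally show ?thesis by (simp add: fps_mult_nth gf_val_def)
qed

lemma gf_val_False: "gf_val False = fps_X + gf_val False ^ 2"
proof (rule fps_ext)
  fix n :: nat
  consider "n = 0" | "n = 1" | "n > 1" by linarith
  then show "fps_nth (gf_val False) n = fps_nth (fps_X + gf_val False ^ 2) n"
  proof cases
    case 3
    then have "num_val False n = card (rows_val2 False False 0 (0 + n))"
      by (simp add: num_val_def rows_val_False)
    with 3 show ?thesis
      using real_card_rows_val2[of False False 0 n] by (simp add: gf_val_def power2_eq_square)
  qed (simp_all add: gf_val_def power2_eq_square fps_mult_nth)
qed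

text \<open>The term \<open>fps_X\<close> is the single-variable row; the others are the three true
  lines of the truth table, the two mixed ones merging by commutativity.\<close>

lemma gf_val_True: "gf_val True = fps_X + gf_val True ^ 2 + 2 * gf_val True * gf_val False"
proof -
  have "gf_val True = fps_X + gf_val True * gf_val True + gf_val True * gf_val False
      + gf_val False * gf_val True"
  proof (rule fps_ext)
    fix n :: nat
    consider "n = 0" | "n = 1" | "n > 1" by linarith
    then show "fps_nth (gf_val True) n = fps_nth (fps_X + gf_val True * gf_val True
      + gf_val True * gf_val False + gf_val False * gf_val True) n"
    proof cases
      case 3
      then have "num_val True n = card (rows_val2 True True 0 (0 + n))
        + card (rows_val2 True False 0 (0 + n)) + card (rows_val2 False True 0 (0 + n))"
        by (simp add: num_val_def card_rows_val_True)
      then have "fps_nth (gf_val True) n = real (card (rows_val2 True True 0 (0 + n)))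
        + real (card (rows_val2 True False 0 (0 + n))) + real (card (rows_val2 False True 0 (0 + n)))"
        by (simp add: gf_val_def)
      also have "\<dots> = fps_nth (fps_X + gf_val True * gf_val True
        + gf_val True * gf_val False + gf_val False * gf_val True) n"
        using 3 unfolding real_card_rows_val2 fps_add_nth by simp
      finally show ?thesis .
    qed (simp_all add: gf_val_def fps_mult_nth)
  qed
  then show ?thesis by (simp add: power2_eq_square algebra_simps)
qed

text \<open>The convention that \<open>k1\<close> vanishes at 0 and 1 fits the square, whose factor
  has no constant term.\<close>

lemma K1_eq: "K1 = gf_val True ^ 2"
proof (rule fps_ext)
  fix n :: nat
  consider "n = 0" | "n = 1" | "n > 1" by linarith
  then show "fps_nth K1 n = fps_nth (gf_val True ^ 2) n"
  proof cases
    case 3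
    \<comment> \<open>The variables of \<open>k1\<close> start at 1, so the interval count is used
      with start 1 and excluded end \<open>1 + n\<close>.\<close>
    have "{1..n} = {1..<1 + n}" by auto
    with 3 have "k1 n = card (rows_val2 True True 1 (1 + n))"
      unfolding k1_def rows_def bracketed_formulae_def valuations_def rows_val2_def
      by (auto intro!: arg_cong[where f = card])
    then show ?thesis
      using real_card_rows_val2[of True True 1 n] by (simp add: K1_def power2_eq_square)
  qed (simp_all add: K1_def k1_def gf_val_def power2_eq_square fps_mult_nth)
qed

section \<open>Solving the quadratic equations\<close>

theorem proposition6p17:
  shows "K1 = (1 - 6 * fps_X - fps_sqrt (1 - 4 * fps_X) * fps_sqrt (1 - 8 * fps_X)) / 2"
proof -
  let ?F = "gf_val False" and ?T = "gf_val True"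
  have "(1 - 2 * ?F) ^ 2 = 1 - 4 * fps_X"
    using gf_val_False by algebra
  \<comment> \<open>\<open>gf_val False\<close> has no constant term, so the candidate root has
    constant term 1, which selects the right sign.\<close>
  then have s4: "fps_sqrt (1 - 4 * fps_X) = 1 - 2 * ?F"
    using fps_sqrt_unique[of "1 - 4 * fps_X" "1 - 2 * ?F"] by (simp add: gf_val_def)
  have "(1 - 2 * (?T + ?F)) ^ 2 = 1 - 8 * fps_X"
    using gf_val_False gf_val_True by algebra
  then have s8: "fps_sqrt (1 - 8 * fps_X) = 1 - 2 * (?T + ?F)"
    using fps_sqrt_unique[of "1 - 8 * fps_X" "1 - 2 * (?T + ?F)"] by (simp add: gf_val_def)
  \<comment> \<open>With F and T for \<open>?F\<close> and \<open>?T\<close>, the product is (1 -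
    2F)^2 - 2T(1 - 2F) = 1 - 4X - 2T + 4TF, so the left side is 2(T - X - 2TF), and the equation for
    T turns this into 2T^2.\<close>
  have "1 - 6 * fps_X - (1 - 2 * ?F) * (1 - 2 * (?T + ?F)) = 2 * ?T ^ 2"
    using gf_val_False gf_val_True by algebra
  then show ?thesis
    unfolding s4 s8 K1_eq by simp
qed

end
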